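(* Let $\mathfrak{G}$ be a finite group generated by involutions. Then there is a connected finite simple graph $G$ with a proper edge coloring $\kappa$ such that the coloring group $\mathfrak{G}_\kappa$ is isomorphic to $\mathfrak{G}$.
   Context: A proper edge coloring of a graph $G$ on $k$ colors is a surjective map $\kappa:E(G)\to[k]$ such that edges sharing a vertex receive different colors. For $a\in[k]$, $\tau_a\in S_{V(G)}$ is the product of the transpositions $(i,j)$ over all edges $\{i,j\}$ colored $a$, and the coloring group $\mathfrak{G}_\kappa\le S_{V(G)}$ is the subgroup generated by $\tau_1,\dots,\tau_k$. *)

theory Defs
  imports
    "HOL-Algebra.Bij"
    "HOL-Algebra.Generated_Groups"
    "HOL-Algebra.Multiplicative_Group"
    "HOL-Combinatorics.Transposition"
    "Graph_Theory.Digraph_Component"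
    "Graph_Theory.Pair_Digraph"
begin

(* A finite simple graph is a "pair_graph": a finite, loop-free, symmetric digraph
   whose arcs are ordered pairs.  An undirected edge {u,v} is a pair of opposite arcs. *)

definition edges :: "'v pair_pre_digraph \<Rightarrow> 'v set set" where
  "edges G = {{u, v} | u v. (u, v) \<in> parcs G}"

definition proper_edge_coloring ::
    "'v pair_pre_digraph \<Rightarrow> nat \<Rightarrow> ('v set \<Rightarrow> nat) \<Rightarrow> bool" where
  "proper_edge_coloring G k \<kappa> \<longleftrightarrow>
     \<kappa> ` edges G = {1..k} \<and>
     (\<forall>e\<in>edges G. \<forall>f\<in>edges G. e \<noteq> f \<and> e \<inter> f \<noteq> {} \<longrightarrow> \<kappa> e \<noteq> \<kappa> f)"

definition color_class :: "'v pair_pre_digraph \<Rightarrow> ('v set \<Rightarrow> nat) \<Rightarrow> nat \<Rightarrow> 'v set set" where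
  "color_class G \<kappa> a = {e \<in> edges G. \<kappa> e = a}"

definition edge_transp :: "'v set \<Rightarrow> 'v \<Rightarrow> 'v" where
  "edge_transp e = (THE t. \<exists>i j. e = {i, j} \<and> t = transpose i j)"

lemma edge_transp_doubleton: "edge_transp {i, j} = transpose i j"
  unfolding edge_transp_def
  by (rule the_equality) (auto simp: doubleton_eq_iff transpose_commute)

(* The order of the factors is irrelevant for a proper coloring: see color_class_commute.
   Elements of BijGroup are extensional functions, hence the restriction to the vertices. *)
definition color_perm ::
    "'v pair_pre_digraph \<Rightarrow> ('v set \<Rightarrow> nat) \<Rightarrow> nat \<Rightarrow> 'v \<Rightarrow> 'v" where
  "color_perm G \<kappa> a =
     restrict (Finite_Set.fold (\<lambda>e p. edge_transp e \<circ> p) id (color_class G \<kappa> a)) (pverts G)"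

definition coloring_group ::
    "'v pair_pre_digraph \<Rightarrow> nat \<Rightarrow> ('v set \<Rightarrow> nat) \<Rightarrow> ('v \<Rightarrow> 'v) monoid" where
  "coloring_group G k \<kappa> =
     (BijGroup (pverts G))
       \<lparr>carrier := generate (BijGroup (pverts G)) (color_perm G \<kappa> ` {1..k})\<rparr>"

definition generated_by_involutions :: "('a, 'b) monoid_scheme \<Rightarrow> bool" where
  "generated_by_involutions H \<longleftrightarrow>
     (\<exists>S \<subseteq> {s \<in> carrier H. group.ord H s = 2}. generate H S = carrier H)"

lemma color_class_commute:
  assumes "proper_edge_coloring G k \<kappa>"
  shows "comp_fun_commute_on (color_class G \<kappa> a) (\<lambda>e p. edge_transp e \<circ> p)"
proof
  fix e f assume ef: "e \<in> color_class G \<kappa> a" "f \<in> color_class G \<kappa> a"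
  have "edge_transp f \<circ> edge_transp e = edge_transp e \<circ> edge_transp f"
  proof (cases "e = f")
    case False
    with ef assms have disj: "e \<inter> f = {}"
      by (auto simp: color_class_def proper_edge_coloring_def)
    obtain i j u v where "e = {i, j}" "f = {u, v}"
      using ef by (auto simp: color_class_def edges_def)
    with disj show ?thesis
      by (auto simp: edge_transp_doubleton fun_eq_iff transpose_def)
  qed simp
  then show "(\<circ>) (edge_transp f) \<circ> (\<circ>) (edge_transp e) = (\<circ>) (edge_transp e) \<circ> (\<circ>) (edge_transp f)"
    by (simp add: fun_eq_iff)
qed

lemma (in pair_graph) color_perm_apply:
  assumes col: "proper_edge_coloring G k \<kappa>" and v: "v \<in> pverts G"
  shows "{v, w} \<in> color_class G \<kappa> a \<Longrightarrow> color_perm G \<kappa> a v = w"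
    and "v \<notin> \<Union>(color_class G \<kappa> a) \<Longrightarrow> color_perm G \<kappa> a v = v"
proof -
  interpret C: comp_fun_commute_on "color_class G \<kappa> a" "\<lambda>e p. edge_transp e \<circ> p"
    by (rule color_class_commute[OF col])
  let ?F = "Finite_Set.fold (\<lambda>e p. edge_transp e \<circ> p) id"
  have "edges G = (\<lambda>(u, v). {u, v}) ` parcs G" by (auto simp: edges_def)
  then have fin: "finite (color_class G \<kappa> a)" by (simp add: color_class_def)
  have off: "?F A x = x"
    if "A \<subseteq> color_class G \<kappa> a" "x \<notin> \<Union>A" for A x
  proof -
    have "finite A" using that(1) fin by (rule finite_subset)
    then show ?thesis using that
    proof (induction A)
      case (insert e A)
      obtain i j where e: "e = {i, j}"
        using insert.prems by (auto simp: color_class_def edges_def)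
      have "?F (insert e A) = edge_transp e \<circ> ?F A"
        by (rule C.fold_insert) (use insert in auto)
      then have "?F (insert e A) x = edge_transp e (?F A x)"
        by (simp only: comp_apply)
      also have "?F A x = x"
        by (rule insert.IH) (use insert.prems in auto)
      also have "edge_transp e x = x"
        using e insert.prems by (simp add: edge_transp_doubleton)
      finally show ?case .
    qed simp
  qed
  show "color_perm G \<kappa> a v = v" if "v \<notin> \<Union>(color_class G \<kappa> a)"
    unfolding color_perm_def restrict_def using off[OF subset_refl that] v by (simp only: if_True)
  show "color_perm G \<kappa> a v = w" if e: "{v, w} \<in> color_class G \<kappa> a"
  proof -
    let ?A = "color_class G \<kappa> a - {{v, w}}"
    have A: "insert {v, w} ?A = color_class G \<kappa> a" using e by auto
    have notin: "v \<notin> \<Union>?A"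
    proof
      assume "v \<in> \<Union>?A"
      then obtain f where f: "f \<in> edges G" "\<kappa> f = a" "f \<noteq> {v, w}" "v \<in> f"
        by (auto simp: color_class_def)
      moreover from f have "f \<inter> {v, w} \<noteq> {}" by auto
      moreover have "{v, w} \<in> edges G" "\<kappa> {v, w} = a"
        using e by (simp_all add: color_class_def)
      ultimately show False
        using col unfolding proper_edge_coloring_def by metis
    qed
    have "?F (insert {v, w} ?A) = edge_transp {v, w} \<circ> ?F ?A"
      by (rule C.fold_insert) (use fin e in auto)
    then have "?F (color_class G \<kappa> a) v = edge_transp {v, w} (?F ?A v)"
      by (simp only: A comp_apply)
    also have "?F ?A v = v"
      by (rule off) (use notin in auto)
    also have "edge_transp {v, w} v = w"
      by (simp add: edge_transp_doubleton)
    finally show ?thesis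
      unfolding color_perm_def restrict_def using v by (simp only: if_True)
  qed
qed

end

(* The graph is the Cayley graph of H with respect to a generating set S of involutions, drawn on
   natural numbers: x is joined to s x for s in S, and this edge receives the colour of s.  Since
   s is an involution, the edge determines s, and the s-edges form a perfect matching whose
   permutation is left multiplication by s.  Hence the colouring group is the image of H under
   its (faithful) left regular representation; S generates H, so the graph is connected. *)
theory Submission
  imports Defs
begin

definition left_regular :: "('a, 'b) monoid_scheme \<Rightarrow> 'a \<Rightarrow> 'a \<Rightarrow> 'a" where
  "left_regular G h = (\<lambda>x\<in>carrier G. h \<otimes>\<^bsub>G\<^esub> x)"

definition cayley_graph :: "('a, 'b) monoid_scheme \<Rightarrow> 'a set \<Rightarrow> 'a pair_pre_digraph" where
  "cayley_graph G S =
     \<lparr>pverts = carrier G, parcs = {(x, s \<otimes>\<^bsub>G\<^esub> x) | x s. x \<in> carrier G \<and> s \<in> S}\<rparr>"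

definition edge_generator :: "('a, 'b) monoid_scheme \<Rightarrow> 'a set \<Rightarrow> 'a set \<Rightarrow> 'a" where
  "edge_generator G S e = (THE s. s \<in> S \<and> (\<exists>x\<in>carrier G. e = {x, s \<otimes>\<^bsub>G\<^esub> x}))"

section \<open>Left regular representation, and copies of finite groups on the natural
  numbers\<close>

context group
begin

lemma left_regular_Bij:
  assumes "h \<in> carrier G"
  shows "left_regular G h \<in> Bij (carrier G)"
proof -
  have "bij_betw (\<lambda>x. h \<otimes> x) (carrier G) (carrier G)"
    by (rule bij_betw_byWitness[where f' = "\<lambda>x. inv h \<otimes> x"])
       (use assms in \<open>auto simp: m_assoc[symmetric]\<close>)
  then show ?thesis
    by (simp add: left_regular_def Bij_def bij_betw_restrict_eq)
qed

lemma left_regular_hom: "left_regular G \<in> hom G (BijGroup (carrier G))"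
proof (rule homI)
  fix g h assume gh: "g \<in> carrier G" "h \<in> carrier G"
  then have "left_regular G (g \<otimes> h) = compose (carrier G) (left_regular G g) (left_regular G h)"
    by (auto simp: left_regular_def compose_def fun_eq_iff m_assoc)
  then show "left_regular G (g \<otimes> h) =
      left_regular G g \<otimes>\<^bsub>BijGroup (carrier G)\<^esub> left_regular G h"
    using gh by (simp add: BijGroup_def left_regular_Bij)
qed (simp add: BijGroup_def left_regular_Bij)

lemma left_regular_inj: "inj_on (left_regular G) (carrier G)"
proof (rule inj_onI)
  fix g h assume gh: "g \<in> carrier G" "h \<in> carrier G" "left_regular G g = left_regular G h"
  then have "left_regular G g \<one> = left_regular G h \<one>" by simp
  with gh(1,2) show "g = h" by (simp add: left_regular_def)
qed

lemma involution_of_ord_2: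
  assumes "s \<in> carrier G" "ord s = 2"
  shows "s \<noteq> \<one>" "s \<otimes> s = \<one>"
proof -
  show "s \<noteq> \<one>" using assms ord_eq_1 by auto
  have "s [^] (2::nat) = \<one>" using pow_ord_eq_1[OF assms(1)] assms(2) by simp
  then show "s \<otimes> s = \<one>" using assms by (simp add: numeral_2_eq_2)
qed

text \<open>The final graph must have vertices of type \<open>nat\<close>, so the finite group is
  moved there by transport of structure along an injection of its carrier.\<close>

lemma ex_iso_nat_group:
  assumes "finite (carrier G)"
  shows "\<exists>(K :: nat monoid) f. group K \<and> f \<in> iso G K"
proof -
  obtain f :: "'a \<Rightarrow> nat" where f: "inj_on f (carrier G)"
    using finite_imp_inj_to_nat_seg[OF assms] by blast
  let ?g = "inv_into (carrier G) f"
  define K :: "nat monoid" where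
    "K = \<lparr>carrier = f ` carrier G, monoid.mult = (\<lambda>x y. f (?g x \<otimes> ?g y)), one = f \<one>\<rparr>"
  have iso: "f \<in> iso G K"
    using f by (simp add: iso_iff K_def hom_def)
  moreover have "group K"
    using iso_imp_img_group[OF iso] by (simp add: K_def)
  ultimately show ?thesis by blast
qed

end

text \<open>Order two is split into the two facts that the graph uses: \<open>S_nontrivial\<close>
  excludes loops and \<open>S_involution\<close> makes arcs symmetric. An empty \<open>S\<close> is
  allowed; the group is then trivial and the graph is a single vertex.\<close>

locale involution_generated = group G for G :: "('a, 'b) monoid_scheme" (structure) +
  fixes S :: "'a set"
  assumes finite_carrier: "finite (carrier G)"
    and S_closed: "S \<subseteq> carrier G"
    and S_nontrivial: "s \<in> S \<Longrightarrow> s \<noteq> \<one>"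
    and S_involution: "s \<in> S \<Longrightarrow> s \<otimes> s = \<one>"
    and generate_S: "generate G S = carrier G"
begin

lemma S_carrier [simp]: "s \<in> S \<Longrightarrow> s \<in> carrier G"
  using S_closed by blast

lemma S_cancel [simp]:
  assumes "s \<in> S" "x \<in> carrier G"
  shows "s \<otimes> (s \<otimes> x) = x"
  using assms S_involution[of s] by (simp add: m_assoc[symmetric])

section \<open>The Cayley graph: simplicity and connectedness\<close>

abbreviation "Cay \<equiv> cayley_graph G S"

lemma pverts_cayley [simp]: "pverts Cay = carrier G"
  by (simp add: cayley_graph_def)

lemma parcs_cayley_iff: "(x, y) \<in> parcs Cay \<longleftrightarrow> x \<in> carrier G \<and> (\<exists>s\<in>S. y = s \<otimes> x)"
  by (auto simp: cayley_graph_def)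

lemma edges_cayley: "edges Cay = {{x, s \<otimes> x} | x s. x \<in> carrier G \<and> s \<in> S}"
  by (auto simp: edges_def parcs_cayley_iff)

lemma pair_graph_cayley: "pair_graph Cay"
proof
  show wf: "fst e \<in> pverts Cay" "snd e \<in> pverts Cay" if "e \<in> parcs Cay" for e
    using that by (auto simp: cayley_graph_def)
  show "finite (pverts Cay)" by (simp add: finite_carrier)
  have "parcs Cay \<subseteq> pverts Cay \<times> pverts Cay"
    using wf by (auto simp: mem_Times_iff)
  then show "finite (parcs Cay)"
    by (rule finite_subset) (simp add: finite_carrier)
  show "symmetric Cay"
    unfolding symmetric_def by (auto simp: parcs_cayley_iff intro!: symI) (metis S_cancel)
  show "fst e \<noteq> snd e" if "e \<in> parcs Cay" for e
    using that S_nontrivial by (auto simp: cayley_graph_def)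
qed

lemma connected_cayley: "connected (with_proj Cay)"
proof -
  interpret C: pair_graph Cay by (rule pair_graph_cayley)
  have arc: "x \<rightarrow>\<^sup>*\<^bsub>with_proj Cay\<^esub> (s \<otimes> x)" if "x \<in> carrier G" "s \<in> S" for s x
    using that by (intro C.reachable_adjI) (auto simp: parcs_cayley_iff)
  \<comment> \<open>Induction on the word for \<open>h\<close>. The start \<open>x\<close> stays
    arbitrary because in a product \<open>h1\<close> acts from
    \<open>h2 \<otimes> x\<close>.\<close>
  have reach: "x \<rightarrow>\<^sup>*\<^bsub>with_proj Cay\<^esub> (h \<otimes> x)" if "h \<in> generate G S" "x \<in> carrier G" for h x
    using that
  proof (induction arbitrary: x)
    case one
    then show ?case by simp
  next
    case (incl h)
    then show ?case by (simp add: arc)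
  next
    case (inv h)
    \<comment> \<open>Generators are self-inverse, so an inverse letter is again a single
      arc.\<close>
    then have "inv h = h" using S_involution by (simp add: inv_equality)
    with inv show ?case by (simp add: arc)
  next
    case (eng h1 h2)
    then have "h1 \<in> carrier G" "h2 \<in> carrier G" using generate_S by auto
    then show ?case
      using eng.IH(2)[of x] eng.IH(1)[of "h2 \<otimes> x"] eng.prems
      by (auto simp: m_assoc intro: C.reachable_trans)
  qed
  show ?thesis
  proof (rule C.connectedI)
    fix u v assume "u \<in> pverts Cay" "v \<in> pverts Cay"
    then have uv: "u \<in> carrier G" "v \<in> carrier G" by simp_all
    then have "u \<rightarrow>\<^sup>*\<^bsub>with_proj Cay\<^esub> v"
      \<comment> \<open>The element carrying \<open>u\<close> to \<open>v\<close> by left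
        multiplication is \<open>v \<otimes> inv u\<close>, and it lies in
        \<open>generate G S\<close>.\<close>
      using reach[of "v \<otimes> inv u" u] generate_S by (simp add: m_assoc)
    \<comment> \<open>\<open>connected\<close> refers to the symmetric closure, where a directed
      walk remains a walk.\<close>
    then show "u \<rightarrow>\<^sup>*\<^bsub>with_proj (mk_symmetric (with_proj Cay))\<^esub> v"
      by (rule C.reachable_mk_symmetricI)
  qed auto
qed

text \<open>This justifies the \<open>THE\<close> in \<open>edge_generator\<close>: reading the edge
  from its other end yields the same generator, since \<open>x = t \<otimes> y\<close> gives
  \<open>t \<otimes> x = y\<close>.\<close>

lemma edge_generator_eq:
  assumes "s \<in> S" "x \<in> carrier G"
  shows "edge_generator G S {x, s \<otimes> x} = s"
  unfolding edge_generator_def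
proof (rule the_equality)
  fix t assume "t \<in> S \<and> (\<exists>y\<in>carrier G. {x, s \<otimes> x} = {y, t \<otimes> y})"
  then obtain y where t: "t \<in> S" "y \<in> carrier G" "{x, s \<otimes> x} = {y, t \<otimes> y}" by blast
  from t(3) consider "x = y" "s \<otimes> x = t \<otimes> y" | "x = t \<otimes> y" "s \<otimes> x = y"
    by (auto simp: doubleton_eq_iff)
  then have "s \<otimes> x = t \<otimes> x" using t by cases simp_all
  with assms t show "t = s" by simp
qed (use assms in blast)

section \<open>Colouring edges by their generators, numbered by \<open>c\<close>\<close>

context
  fixes c :: "'a \<Rightarrow> nat" and k :: nat
  assumes c: "bij_betw c S {1..k}"
begin

abbreviation "col \<equiv> \<lambda>e. c (edge_generator G S e)"

lemma proper_edge_coloring_cayley: "proper_edge_coloring Cay k col"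
  unfolding proper_edge_coloring_def
proof (intro conjI ballI impI)
  have "edge_generator G S ` edges Cay = S"
  proof
    \<comment> \<open>The edges at the identity already show every generator.\<close>
    show "S \<subseteq> edge_generator G S ` edges Cay"
    proof
      fix s assume s: "s \<in> S"
      then have "edge_generator G S {\<one>, s \<otimes> \<one>} = s" "{\<one>, s \<otimes> \<one>} \<in> edges Cay"
        using edge_generator_eq[OF s one_closed] unfolding edges_cayley by blast+
      then show "s \<in> edge_generator G S ` edges Cay" by (metis imageI)
    qed
  qed (auto simp: edges_cayley edge_generator_eq)
  then show "col ` edges Cay = {1..k}"
    using c by (simp add: bij_betw_def image_image[symmetric])
next
  fix e f assume e: "e \<in> edges Cay" and f: "f \<in> edges Cay" and ef: "e \<noteq> f \<and> e \<inter> f \<noteq> {}"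
  from ef obtain v where v: "v \<in> e" "v \<in> f" by blast
  \<comment> \<open>Either endpoint can serve as base point: if \<open>v = s \<otimes> x\<close>
    then \<open>x = s \<otimes> v\<close>. Distinct edges at \<open>v\<close> thus have distinct
    generators, and \<open>c\<close> is injective on \<open>S\<close>.\<close>
  have star: "\<exists>s\<in>S. v \<in> carrier G \<and> d = {v, s \<otimes> v}" if "d \<in> edges Cay" "v \<in> d" for d
    using that by (force simp: edges_cayley insert_commute)
  obtain s t where "s \<in> S" "t \<in> S" "e = {v, s \<otimes> v}" "f = {v, t \<otimes> v}" "v \<in> carrier G"
    using star[OF e v(1)] star[OF f v(2)] by blast
  with ef show "col e \<noteq> col f"
    using c by (auto simp: edge_generator_eq bij_betw_def inj_on_eq_iff)
qed

lemma color_perm_cayley: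
  assumes s: "s \<in> S"
  shows "color_perm Cay col (c s) = left_regular G s"
proof
  fix x
  show "color_perm Cay col (c s) x = left_regular G s x"
  proof (cases "x \<in> carrier G")
    case True
    then have "{x, s \<otimes> x} \<in> color_class Cay col (c s)"
      using s by (auto simp: color_class_def edge_generator_eq edges_cayley)
    then show ?thesis
      using pair_graph.color_perm_apply(1)[OF pair_graph_cayley proper_edge_coloring_cayley] True
      by (simp add: left_regular_def)
  \<comment> \<open>Off the vertex set both restricted functions are
    \<open>undefined\<close>.\<close>
  qed (simp add: color_perm_def left_regular_def)
qed

text \<open>A homomorphism maps the subgroup generated by \<open>S\<close> onto the one generated by
  the image of \<open>S\<close>, so the colouring group is the whole image of
  \<open>left_regular G\<close>, which is injective.\<close>

lemma coloring_group_cayley_iso: "coloring_group Cay k col \<cong> G"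
proof -
  let ?B = "BijGroup (carrier G)"
  interpret L: group_hom G ?B "left_regular G"
    by (intro group_hom.intro group_hom_axioms.intro group_axioms group_BijGroup left_regular_hom)
  have "color_perm Cay col ` {1..k} = left_regular G ` S"
    unfolding bij_betw_imp_surj_on[OF c, symmetric] by (simp add: image_image color_perm_cayley)
  then have "coloring_group Cay k col = ?B\<lparr>carrier := left_regular G ` carrier G\<rparr>"
    by (simp add: coloring_group_def L.generate_img[OF S_closed] generate_S)
  then have "left_regular G \<in> iso G (coloring_group Cay k col)"
    using left_regular_hom left_regular_inj by (simp add: iso_iff hom_def)
  then show ?thesis
    by (intro iso_sym) (auto simp: is_iso_def)
qed

end

end

theorem theorem2p2:
  fixes H :: "('a, 'b) monoid_scheme"
  assumes "group H"
    and "finite (carrier H)"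
    and "generated_by_involutions H"
  shows "\<exists>(G :: nat pair_pre_digraph) k \<kappa>.
           pair_graph G \<and> connected (with_proj G) \<and>
           proper_edge_coloring G k \<kappa> \<and>
           coloring_group G k \<kappa> \<cong> H"
proof -
  interpret H: group H by fact
  obtain S where S: "S \<subseteq> carrier H" "\<And>s. s \<in> S \<Longrightarrow> H.ord s = 2" "generate H S = carrier H"
    using assms(3) by (auto simp: generated_by_involutions_def)
  obtain K :: "nat monoid" and f where K: "group K" and f: "f \<in> iso H K"
    using H.ex_iso_nat_group[OF assms(2)] by blast
  interpret f: group_hom H K f
    using K f by (intro group_hom.intro group_hom_axioms.intro H.group_axioms) (simp_all add: iso_iff)
  have inj: "inj_on f (carrier H)" and surj: "f ` carrier H = carrier K"
    using f by (simp_all add: iso_iff)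
  \<comment> \<open>The construction is applied to the copy \<open>K\<close>; the isomorphism
    \<open>f\<close> carries over generation, nontriviality and the involution law.\<close>
  interpret K: involution_generated K "f ` S"
  proof
    show "finite (carrier K)" using assms(2) surj by (metis finite_imageI)
    show "f ` S \<subseteq> carrier K" using S(1) by auto
    show "generate K (f ` S) = carrier K"
      using f.generate_img[OF S(1)] S(3) surj by simp
  next
    fix t assume "t \<in> f ` S"
    then obtain s where s: "s \<in> S" "s \<in> carrier H" "t = f s" using S(1) by blast
    note inv = H.involution_of_ord_2[OF s(2) S(2)[OF s(1)]]
    show "t \<noteq> \<one>\<^bsub>K\<^esub>"
      using inv(1) s inj_onD[OF inj, of s "\<one>\<^bsub>H\<^esub>"] by auto
    show "t \<otimes>\<^bsub>K\<^esub> t = \<one>\<^bsub>K\<^esub>"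
      using inv(2) s by (metis f.hom_mult f.hom_one)
  qed
  have "finite (f ` S)"
    using K.S_closed K.finite_carrier by (rule finite_subset)
  then obtain c where c: "bij_betw c (f ` S) {1..card (f ` S)}"
    using ex_bij_betw_finite_nat by (metis bij_betw_iff_card card_atLeastAtMost diff_Suc_1 finite_atLeastAtMost)
  have "H \<cong> K" using f by (auto simp: is_iso_def)
  then have "K \<cong> H" by (rule H.iso_sym)
  then have "coloring_group (cayley_graph K (f ` S)) (card (f ` S))
      (\<lambda>e. c (edge_generator K (f ` S) e)) \<cong> H"
    by (rule iso_trans[OF K.coloring_group_cayley_iso[OF c]])
  then show ?thesis
    using K.pair_graph_cayley K.connected_cayley K.proper_edge_coloring_cayley[OF c] by blast
qed

end
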